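(* Let $A^+(\omega)=\big(\mathfrak a^{(0)}(\omega)\ \ \mathfrak a^{(1)}(\omega)\big)$ be an $M^+$-inner $(2\times2)$-matrix function, unitary for a.e. $\omega\in\partial\mathbb D$, with columns $\mathfrak a^{(0)},\mathfrak a^{(1)}\in H^+_{\mathbb C^2}$ whose Taylor coefficients satisfy $\|a^{(0)}_0\|<1$ and conditions (I)--(V) of the context. Given an arbitrary constant unitary $(2\times2)$-matrix $U$, consider the $(2\times2)$-matrix function $B^+(\omega)$ defined by $$B^+(\omega)=\big(\mathfrak b^{(0)}(\omega)\ \ \mathfrak b^{(1)}(\omega)\big):=A^+(\omega)\cdot U.$$ Then $B^+(\omega)$ is also an $M^+$-inner $(2\times2)$-matrix function, unitary for a.e. $\omega\in\partial\mathbb D$, and such that $\mathfrak b^{(0)},\mathfrak b^{(1)}$ verify conditions (I)--(V) (with the coefficients $a^{(j)}_k$ replaced throughout by the Taylor coefficients $b^{(j)}_k$ of $\mathfrak b^{(j)}$).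
   Context: Inner products $\langle\cdot,\cdot\rangle$ and norms $\|\cdot\|$ of vectors are those of $\mathbb C^2$; inner products are linear in the first argument. $\partial\mathbb D$ is the unit circle in $\mathbb C$. $H^+_{\mathbb C^2}=H^+(\partial\mathbb D;\mathbb C^2)$ is the Hardy space of (boundary) functions $\sum_{k\ge0}\omega^kh_k$ with $h_k\in\mathbb C^2$ and $\sum_k\|h_k\|^2<\infty$. An $M^+$-inner $(2\times2)$-matrix function is a weakly measurable function $A^+$ from $\partial\mathbb D$ to the complex $(2\times2)$-matrices (operators on $\mathbb C^2$) that maps constant functions $\partial\mathbb D\to\mathbb C^2$ into $H^+_{\mathbb C^2}$ and such that $A^+(\omega)$ is, for a.e. $\omega\in\partial\mathbb D$, a partial isometry on $\mathbb C^2$ with the same initial space (independent of $\omega$). A partial isometry with initial space $M$ is an operator that is isometric on $M$ and zero on $M^\perp$. For a pair of functions $\mathfrak a^{(j)}(\omega)=\sum_{k\ge0}\omega^ka^{(j)}_k$ ($j=0,1$) in $H^+_{\mathbb C^2}$, with $a^{(j)}_k\in\mathbb C^2$, the conditions are: (I) $\dfrac{|\langle a^{(0)}_p,a^{(0)}_0\rangle|^2}{1-\|a^{(0)}_0\|^2}=1-\sum_{k=0}^p\|a^{(0)}_k\|^2$ for $p>0$; (II) $\dfrac{|\langle a^{(1)}_p,a^{(0)}_0\rangle|^2}{1-\|a^{(0)}_0\|^2}=1-\sum_{k=0}^p\|a^{(1)}_k\|^2$ for $p\ge0$; (III) $\dfrac{\langle a^{(0)}_{p'},a^{(0)}_0\rangle\langle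 a^{(0)}_0,a^{(0)}_p\rangle}{1-\|a^{(0)}_0\|^2}=-\sum_{r=0}^p\langle a^{(0)}_{p'-r},a^{(0)}_{p-r}\rangle$ for $0<p<p'$; (IV) $\dfrac{\langle a^{(1)}_{p'},a^{(0)}_0\rangle\langle a^{(0)}_0,a^{(1)}_p\rangle}{1-\|a^{(0)}_0\|^2}=-\sum_{r=0}^p\langle a^{(1)}_{p'-r},a^{(1)}_{p-r}\rangle$ for $0\le p<p'$; (V) $\dfrac{\langle a^{(1)}_{p'},a^{(0)}_0\rangle\langle a^{(0)}_0,a^{(0)}_p\rangle}{1-\|a^{(0)}_0\|^2}$ equals $-\sum_{r=0}^p\langle a^{(1)}_{p'-r},a^{(0)}_{p-r}\rangle$ if $0<p\le p'$, and equals $-\sum_{r=0}^{p'}\langle a^{(1)}_{p'-r},a^{(0)}_{p-r}\rangle$ if $0\le p'<p$.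
   Formalization: For some U the norm of b^(0)_0 is 1, so the fractions in (I)–(V) for B are undefined (e.g. A = diag((ω+s)/(1+sω), 1), U the swap); when the denominator is 0 each equation is read with the denominator cleared, i.e. numerator = 0. *)

theory Defs
  imports "HOL-Analysis.Analysis"
begin

text \<open>The library's \<open>\<bullet>\<close> on \<^typ>\<open>complex^2\<close> is the real inner product (the real part of
  \<open>cinner\<close>). The library's \<^const>\<open>norm\<close> on \<^typ>\<open>complex^2\<close> is the Hermitian norm.\<close>

definition cinner :: "complex^2 \<Rightarrow> complex^2 \<Rightarrow> complex" where
  "cinner x y = (\<Sum>i\<in>UNIV. x $ i * cnj (y $ i))"

definition conj_transpose :: "complex^2^2 \<Rightarrow> complex^2^2" where
  "conj_transpose T = (\<chi> i j. cnj (T $ j $ i))"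

definition unitary_matrix :: "complex^2^2 \<Rightarrow> bool" where
  "unitary_matrix T \<longleftrightarrow> conj_transpose T ** T = mat 1 \<and> T ** conj_transpose T = mat 1"

text \<open>The locale instance \<open>vec\<close> has the complex scalars, so \<open>M\<close> is a complex subspace.\<close>

definition partial_isometry_with_initial_space ::
    "complex^2^2 \<Rightarrow> (complex^2) set \<Rightarrow> bool" where
  "partial_isometry_with_initial_space T M \<longleftrightarrow>
     vec.subspace M \<and>
     (\<forall>x\<in>M. norm (T *v x) = norm x) \<and>
     (\<forall>x. (\<forall>y\<in>M. cinner x y = 0) \<longrightarrow> T *v x = 0)"

text \<open>Normalised Lebesgue (arc length) measure on the unit circle, completed so that
  measurability and ``almost everywhere'' have their Lebesgue meaning. Functions on the circle
  are total functions on \<^typ>\<open>complex\<close>; their values off the circle play no role.\<close>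

definition circle_measure :: "complex measure" where
  "circle_measure =
     completion (distr (uniform_measure lborel {0..<2 * pi})
       (restrict_space borel (sphere 0 1)) cis)"

text \<open>\<open>f(\<omega>) = (\<Sum>k. \<omega>^k h\<^sub>k)\<close> with square-summable coefficients, the series converging in
  \<open>L\<^sup>2\<close> of the circle. The \<open>L\<^sup>2\<close> distance is a nonnegative integral, which is infinite
  rather than \<open>0\<close> when the integrand is not integrable.\<close>

definition hardy_series :: "(complex \<Rightarrow> complex^2) \<Rightarrow> (nat \<Rightarrow> complex^2) \<Rightarrow> bool" where
  "hardy_series f h \<longleftrightarrow>
     f \<in> borel_measurable circle_measure \<and>
     summable (\<lambda>k. (norm (h k))\<^sup>2) \<and>
     (\<lambda>n. \<integral>\<^sup>+\<omega>. ennreal ((norm (f \<omega> - (\<Sum>k<n. \<omega> ^ k *s h k)))\<^sup>2) \<partial>circle_measure)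
        \<longlonglongrightarrow> 0"

definition hardy_space :: "(complex \<Rightarrow> complex^2) set" where
  "hardy_space = {f. \<exists>h. hardy_series f h}"

definition taylor_coeffs :: "(complex \<Rightarrow> complex^2) \<Rightarrow> nat \<Rightarrow> complex^2" where
  "taylor_coeffs f = (THE h. hardy_series f h)"

definition M_plus_inner :: "(complex \<Rightarrow> complex^2^2) \<Rightarrow> bool" where
  "M_plus_inner A \<longleftrightarrow>
     (\<forall>h k. (\<lambda>\<omega>. cinner (A \<omega> *v h) k) \<in> borel_measurable circle_measure) \<and>
     (\<forall>h. (\<lambda>\<omega>. A \<omega> *v h) \<in> hardy_space) \<and>
     (\<exists>M. AE \<omega> in circle_measure. partial_isometry_with_initial_space (A \<omega>) M)"

text \<open>The equation \<open>num / den = r\<close>. In HOL, \<open>x / 0 = 0\<close>, which is not what is meant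
  if \<open>den = 0\<close>; there the equation is read with its denominator cleared, \<open>num = den * r\<close>,
  i.e. \<open>num = 0\<close>.\<close>

definition quotient_eq :: "'a::field \<Rightarrow> 'a \<Rightarrow> 'a \<Rightarrow> bool" where
  "quotient_eq num den r \<longleftrightarrow> (if den = 0 then num = 0 else num / den = r)"

text \<open>In the following, \<open>a\<close> and \<open>b\<close> are the coefficient sequences of the first and of the
  second column, respectively.\<close>

definition condition_I :: "(nat \<Rightarrow> complex^2) \<Rightarrow> bool" where
  "condition_I a \<longleftrightarrow>
     (\<forall>p>0. quotient_eq ((cmod (cinner (a p) (a 0)))\<^sup>2) (1 - (norm (a 0))\<^sup>2)
        (1 - (\<Sum>k\<le>p. (norm (a k))\<^sup>2)))"

definition condition_II :: "(nat \<Rightarrow> complex^2) \<Rightarrow> (nat \<Rightarrow> complex^2) \<Rightarrow> bool" where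
  "condition_II a b \<longleftrightarrow>
     (\<forall>p. quotient_eq ((cmod (cinner (b p) (a 0)))\<^sup>2) (1 - (norm (a 0))\<^sup>2)
        (1 - (\<Sum>k\<le>p. (norm (b k))\<^sup>2)))"

definition condition_III :: "(nat \<Rightarrow> complex^2) \<Rightarrow> bool" where
  "condition_III a \<longleftrightarrow>
     (\<forall>p p'. 0 < p \<and> p < p' \<longrightarrow>
        quotient_eq (cinner (a p') (a 0) * cinner (a 0) (a p))
          (complex_of_real (1 - (norm (a 0))\<^sup>2))
          (- (\<Sum>r\<le>p. cinner (a (p' - r)) (a (p - r)))))"

definition condition_IV :: "(nat \<Rightarrow> complex^2) \<Rightarrow> (nat \<Rightarrow> complex^2) \<Rightarrow> bool" where
  "condition_IV a b \<longleftrightarrow>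
     (\<forall>p p'. p < p' \<longrightarrow>
        quotient_eq (cinner (b p') (a 0) * cinner (a 0) (b p))
          (complex_of_real (1 - (norm (a 0))\<^sup>2))
          (- (\<Sum>r\<le>p. cinner (b (p' - r)) (b (p - r)))))"

definition condition_V :: "(nat \<Rightarrow> complex^2) \<Rightarrow> (nat \<Rightarrow> complex^2) \<Rightarrow> bool" where
  "condition_V a b \<longleftrightarrow>
     (\<forall>p p'. 0 < p \<and> p \<le> p' \<longrightarrow>
        quotient_eq (cinner (b p') (a 0) * cinner (a 0) (a p))
          (complex_of_real (1 - (norm (a 0))\<^sup>2))
          (- (\<Sum>r\<le>p. cinner (b (p' - r)) (a (p - r))))) \<and>
     (\<forall>p p'. p' < p \<longrightarrow>
        quotient_eq (cinner (b p') (a 0) * cinner (a 0) (a p))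
          (complex_of_real (1 - (norm (a 0))\<^sup>2))
          (- (\<Sum>r\<le>p'. cinner (b (p' - r)) (a (p - r)))))"

definition conditions_I_to_V :: "(nat \<Rightarrow> complex^2) \<Rightarrow> (nat \<Rightarrow> complex^2) \<Rightarrow> bool" where
  "conditions_I_to_V a b \<longleftrightarrow>
     condition_I a \<and> condition_II a b \<and> condition_III a \<and> condition_IV a b \<and> condition_V a b"

end

theory Submission
  imports Defs
begin

text \<open>
  Put the columns of \<open>A\<^sup>+\<close> into one family \<open>a i k\<close> and regard the pairs \<open>(i, k)\<close> as the
  indices of an infinite Hermitian matrix \<open>D\<close>, the identity minus the Gram matrix whose entries are
  the truncated sums on the right-hand sides of (I)--(V) (\<open>gram_defect\<close>). Write
  \<open>o = (1, 0)\<close> for the index of the constant coefficient of the first column. Its truncated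
  sums have a single term, so
  \<open>D x o = - \<langle>a\<^sub>x, a\<^sub>o\<rangle>\<close> for \<open>x \<noteq> o\<close>, and \<open>D o o = 1 - \<parallel>a\<^sub>o\<parallel>\<^sup>2\<close> is the common denominator.
  With the denominator cleared, all five conditions are therefore instances of the single equation
  \<open>D x o * D o y = D o o * D x y\<close>, and together with Hermitian symmetry they amount to it for all
  \<open>x\<close> and \<open>y\<close> (\<open>conditions_iff_rank_one\<close>): the \<open>2 \<times> 2\<close> minors of \<open>D\<close> containing
  the pivot \<open>(o, o)\<close> vanish.

  Since \<open>D o o > 0\<close> by hypothesis, \<open>D\<close> is a product \<open>v x * w y\<close>, a property that does not refer to
  the pivot any more. Replacing \<open>A\<^sup>+\<close> by \<open>A\<^sup>+ U\<close> replaces each \<open>2 \<times> 2\<close> block of \<open>D\<close> by its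
  conjugate under \<open>U\<close> -- unitarity of \<open>U\<close> is what keeps the identity in place
  (\<open>gram_defect_unitary_change\<close>) -- so the new matrix is again a product, and the minors
  at its pivot vanish. This remains meaningful when the new pivot is \<open>0\<close>, where the conditions ask
  for vanishing numerators.

  The analytic part is that the Taylor coefficients of \<open>B\<^sup>+\<close> are the combinations of those of
  \<open>A\<^sup>+\<close> given by \<open>U\<close>. Limits in \<open>L\<^sup>2\<close> respect linear combinations, and Parseval's
  identity for vector polynomials makes the coefficients unique.
\<close>

section \<open>The Hermitian product and unitary matrices\<close>

lemma cinner_add_left: "cinner (x + y) z = cinner x z + cinner y z"
  by (simp add: cinner_def sum.distrib distrib_right)

lemma cinner_scale_left: "cinner (c *s x) z = c * cinner x z"
  by (simp add: cinner_def sum_distrib_left mult.assoc)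

lemma cnj_cinner: "cnj (cinner x y) = cinner y x"
  by (simp add: cinner_def mult.commute)

lemma cinner_sum_left: "cinner (sum f S) z = (\<Sum>i\<in>S. cinner (f i) z)"
  by (induction S rule: infinite_finite_induct) (simp_all add: cinner_add_left, simp_all add: cinner_def)

lemma cinner_scale_right: "cinner x (c *s z) = cnj c * cinner x z"
  by (metis cinner_scale_left cnj_cinner complex_cnj_mult)

lemma cinner_sum_right: "cinner z (sum f S) = (\<Sum>i\<in>S. cinner z (f i))"
  using arg_cong[OF cinner_sum_left[of f S z], of cnj] by (simp add: cnj_cinner)

lemma cinner_self: "cinner x x = complex_of_real ((norm x)\<^sup>2)"
  by (simp add: cinner_def norm_vec_def L2_set_def complex_norm_square sum_nonneg del: of_real_power)

lemma unitary_matrix_mult: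
  assumes "unitary_matrix S" "unitary_matrix T"
  shows "unitary_matrix (S ** T)"
proof -
  have ct: "conj_transpose (S ** T) = conj_transpose T ** conj_transpose S"
    by (simp add: conj_transpose_def matrix_matrix_mult_def vec_eq_iff mult.commute)
  have "conj_transpose T ** (conj_transpose S ** S) ** T = mat 1"
    "S ** (T ** conj_transpose T) ** conj_transpose S = mat 1"
    using assms by (simp_all add: unitary_matrix_def)
  then show ?thesis
    by (simp add: unitary_matrix_def ct matrix_mul_assoc)
qed

lemma cinner_matrix_adjoint: "cinner (T *v x) y = cinner x (conj_transpose T *v y)"
  by (simp add: cinner_def conj_transpose_def matrix_vector_mult_def sum_2 algebra_simps)

lemma unitary_matrix_norm:
  assumes "unitary_matrix T"
  shows "norm (T *v x) = norm x"
proof -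
  have "cinner (T *v x) (T *v x) = cinner x x"
    using assms by (simp add: cinner_matrix_adjoint matrix_vector_mul_assoc unitary_matrix_def)
  then have "(norm (T *v x))\<^sup>2 = (norm x)\<^sup>2"
    by (simp only: cinner_self of_real_eq_iff)
  then show ?thesis by simp
qed

lemma unitary_matrix_partial_isometry:
  assumes "unitary_matrix T"
  shows "partial_isometry_with_initial_space T UNIV"
proof -
  have "x = 0" if "\<forall>y. cinner x y = 0" for x
    using that[rule_format, of x] by (simp add: cinner_self)
  then show ?thesis
    unfolding partial_isometry_with_initial_space_def
    using assms by (metis UNIV_I unitary_matrix_norm matrix_vector_mult_0_right vec.subspace_UNIV)
qed

section \<open>The five conditions as vanishing minors\<close>

text \<open>Both sides say \<open>num = 0\<close> when the denominator vanishes, so the conditions can be treated as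
  polynomial identities throughout.\<close>

lemma quotient_eq_iff: "quotient_eq num den r \<longleftrightarrow> num = den * r"
  by (auto simp: quotient_eq_def field_simps)

text \<open>The transpose of \<open>I - L\<^sup>* L\<close>, where \<open>L\<close> is the infinite block upper
  triangular Toeplitz matrix with \<open>(r, p)\<close> block \<open>(a 1 (p - r), a 2 (p - r))\<close>, \<open>r \<le> p\<close>.\<close>

definition gram_defect :: "(2 \<Rightarrow> nat \<Rightarrow> complex^2) \<Rightarrow> 2 \<times> nat \<Rightarrow> 2 \<times> nat \<Rightarrow> complex" where
  "gram_defect a x y = (if x = y then 1 else 0)
     - (\<Sum>r\<le>min (snd x) (snd y). cinner (a (fst x) (snd x - r)) (a (fst y) (snd y - r)))"

lemma cnj_gram_defect: "cnj (gram_defect a x y) = gram_defect a y x"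
  by (simp add: gram_defect_def cnj_cinner min.commute)

text \<open>For \<open>D z z \<noteq> 0\<close> this says that \<open>D\<close> has rank one. Stated through minors it also covers
  \<open>D z z = 0\<close>, where it only says that all products \<open>D x z * D z y\<close> vanish.\<close>

definition rank_one_at :: "('i \<Rightarrow> 'i \<Rightarrow> 'k::comm_ring_1) \<Rightarrow> 'i \<Rightarrow> bool" where
  "rank_one_at D z \<longleftrightarrow> (\<forall>x y. D x z * D z y = D z z * D x y)"

abbreviation minor_vanishes :: "(2 \<Rightarrow> nat \<Rightarrow> complex^2) \<Rightarrow> 2 \<times> nat \<Rightarrow> 2 \<times> nat \<Rightarrow> bool" where
  "minor_vanishes a x y \<equiv> gram_defect a x (1, 0) * gram_defect a (1, 0) y =
     gram_defect a (1, 0) (1, 0) * gram_defect a x y"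

lemma minor_vanishes_commute: "minor_vanishes a x y \<longleftrightarrow> minor_vanishes a y x"
proof -
  have "minor_vanishes a y x" if "minor_vanishes a x y" for x y
    using arg_cong[OF that, of cnj] by (simp add: cnj_gram_defect mult.commute)
  then show ?thesis by blast
qed

text \<open>Row and column \<open>(1, 0)\<close> of the defect are single inner products with \<open>a 1 0\<close>, which is how
  the numerators and the denominator of the conditions arise.\<close>

lemma minor_vanishes_iff:
  assumes "x \<noteq> (1, 0)" "y \<noteq> (1, 0)"
  shows "minor_vanishes a x y \<longleftrightarrow>
    cinner (a (fst x) (snd x)) (a 1 0) * cinner (a 1 0) (a (fst y) (snd y)) =
    complex_of_real (1 - (norm (a 1 0))\<^sup>2) * gram_defect a x y"
  using assms by (simp add: gram_defect_def cinner_self)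

lemma gram_defect_diagonal:
  "gram_defect a (i, p) (i, p) = complex_of_real (1 - (\<Sum>k\<le>p. (norm (a i k))\<^sup>2))"
proof -
  have "(\<Sum>r\<le>p. cinner (a i (p - r)) (a i (p - r))) = (\<Sum>k\<le>p. cinner (a i k) (a i k))"
    by (rule sum.reindex_bij_witness[of _ "\<lambda>r. p - r" "\<lambda>r. p - r"]) auto
  then show ?thesis by (simp add: gram_defect_def cinner_self)
qed

lemma minor_vanishes_diagonal:
  assumes "(i, p) \<noteq> (1, 0)"
  shows "minor_vanishes a (i, p) (i, p) \<longleftrightarrow>
    (cmod (cinner (a i p) (a 1 0)))\<^sup>2 =
      (1 - (norm (a 1 0))\<^sup>2) * (1 - (\<Sum>k\<le>p. (norm (a i k))\<^sup>2))"
proof -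
  have *: "cinner (a i p) (a 1 0) * cinner (a 1 0) (a i p) =
      complex_of_real ((cmod (cinner (a i p) (a 1 0)))\<^sup>2)"
    by (simp add: complex_norm_square cnj_cinner del: of_real_power)
  show ?thesis
    unfolding minor_vanishes_iff[OF assms assms] fst_conv snd_conv
    by (simp only: * gram_defect_diagonal of_real_mult[symmetric] of_real_eq_iff)
qed

lemma minor_vanishes_offdiagonal:
  assumes "(i, p') \<noteq> (1, 0)" "(j, p) \<noteq> (1, 0)" "(i, p') \<noteq> (j, p)"
  shows "minor_vanishes a (i, p') (j, p) \<longleftrightarrow>
    cinner (a i p') (a 1 0) * cinner (a 1 0) (a j p) =
    complex_of_real (1 - (norm (a 1 0))\<^sup>2) *
      (- (\<Sum>r\<le>min p' p. cinner (a i (p' - r)) (a j (p - r))))"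
  unfolding minor_vanishes_iff[OF assms(1,2)] using assms(3)
  by (auto simp: gram_defect_def)

text \<open>Conditions (I) and (II) are the diagonal equations, (III) and (IV) those below the diagonal
  within one column, and (V) those between the two columns. The remaining ones are their complex
  conjugates, or trivial because they involve the pivot.\<close>

lemma conditions_iff_rank_one:
  "conditions_I_to_V (a 1) (a 2) \<longleftrightarrow> rank_one_at (gram_defect a) (1, 0)"
proof -
  have 1: "condition_I (a 1) \<longleftrightarrow> (\<forall>p>0. minor_vanishes a (1, p) (1, p))"
    by (simp add: condition_I_def quotient_eq_iff minor_vanishes_diagonal del: of_real_diff)
  have 2: "condition_II (a 1) (a 2) \<longleftrightarrow> (\<forall>p. minor_vanishes a (2, p) (2, p))"
    by (simp add: condition_II_def quotient_eq_iff minor_vanishes_diagonal del: of_real_diff)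
  have 3: "condition_III (a 1) \<longleftrightarrow>
      (\<forall>p p'. 0 < p \<and> p < p' \<longrightarrow> minor_vanishes a (1, p') (1, p))"
    by (auto simp: condition_III_def quotient_eq_iff minor_vanishes_offdiagonal min_def
        simp del: of_real_diff)
  have 4: "condition_IV (a 1) (a 2) \<longleftrightarrow>
      (\<forall>p p'. p < p' \<longrightarrow> minor_vanishes a (2, p') (2, p))"
    by (auto simp: condition_IV_def quotient_eq_iff minor_vanishes_offdiagonal min_def
        simp del: of_real_diff)
  have 5: "condition_V (a 1) (a 2) \<longleftrightarrow> (\<forall>p p'. 0 < p \<longrightarrow> minor_vanishes a (2, p') (1, p))"
  proof -
    have le: "minor_vanishes a (2, p') (1, p) \<longleftrightarrow>
        cinner (a 2 p') (a 1 0) * cinner (a 1 0) (a 1 p) =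
        complex_of_real (1 - (norm (a 1 0))\<^sup>2) *
          (- (\<Sum>r\<le>p. cinner (a 2 (p' - r)) (a 1 (p - r))))"
      if "0 < p \<and> p \<le> p'" for p p'
      using that by (subst minor_vanishes_offdiagonal) (auto simp: min_absorb2)
    have gt: "minor_vanishes a (2, p') (1, p) \<longleftrightarrow>
        cinner (a 2 p') (a 1 0) * cinner (a 1 0) (a 1 p) =
        complex_of_real (1 - (norm (a 1 0))\<^sup>2) *
          (- (\<Sum>r\<le>p'. cinner (a 2 (p' - r)) (a 1 (p - r))))"
      if "p' < p" for p p'
      using that by (subst minor_vanishes_offdiagonal) (auto simp: min_absorb1)
    have "condition_V (a 1) (a 2) \<longleftrightarrow>
        (\<forall>p p'. 0 < p \<and> p \<le> p' \<longrightarrow> minor_vanishes a (2, p') (1, p)) \<and>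
        (\<forall>p p'. p' < p \<longrightarrow> minor_vanishes a (2, p') (1, p))"
      unfolding condition_V_def quotient_eq_iff using le gt by blast
    also have "\<dots> \<longleftrightarrow> (\<forall>p p'. 0 < p \<longrightarrow> minor_vanishes a (2, p') (1, p))"
      by (metis not_less gr_zeroI not_less_zero)
    finally show ?thesis .
  qed
  have all_minors: "minor_vanishes a x y"
    if C: "condition_I (a 1)" "condition_II (a 1) (a 2)" "condition_III (a 1)"
      "condition_IV (a 1) (a 2)" "condition_V (a 1) (a 2)" for x y
  proof (cases "x = (1, 0) \<or> y = (1, 0)")
    case True
    then show ?thesis by (auto simp: mult.commute)
  next
    case False
    have same: "minor_vanishes a (i, p') (i, p)"
      if "(i, p') \<noteq> (1, 0)" "(i, p) \<noteq> (1, 0)" "p \<le> p'" for i p p'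
    proof (cases "p = p'")
      case True
      with that C(1,2)[unfolded 1 2] show ?thesis using exhaust_2[of i] by auto
    next
      case False
      with that C(3,4)[unfolded 3 4] show ?thesis using exhaust_2[of i] by auto
    qed
    have mixed: "minor_vanishes a (2, p') (1, p)" if "(1::2, p) \<noteq> (1, 0)" for p p'
      using that C(5)[unfolded 5] by auto
    obtain i p' j p where xy: "x = (i, p')" "y = (j, p)"
      by (cases x, cases y) auto
    consider "i = j" "p \<le> p'" | "i = j" "p' \<le> p" | "i = 2" "j = 1" | "i = 1" "j = 2"
      using exhaust_2[of i] exhaust_2[of j] by fastforce
    then show ?thesis
    proof cases
      case 1
      with False xy same show ?thesis by blast
    next
      case 2
      with False xy same have "minor_vanishes a y x" by blast
      then show ?thesis by (simp only: minor_vanishes_commute[of a x y])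
    next
      case 3
      with False xy mixed show ?thesis by blast
    next
      case 4
      with False xy mixed have "minor_vanishes a y x" by blast
      then show ?thesis by (simp only: minor_vanishes_commute[of a x y])
    qed
  qed
  show ?thesis
  proof
    assume "conditions_I_to_V (a 1) (a 2)"
    then show "rank_one_at (gram_defect a) (1, 0)"
      unfolding conditions_I_to_V_def rank_one_at_def by (auto intro: all_minors)
  next
    assume "rank_one_at (gram_defect a) (1, 0)"
    then show "conditions_I_to_V (a 1) (a 2)"
      unfolding conditions_I_to_V_def 1 2 3 4 5 rank_one_at_def by simp
  qed
qed

section \<open>Invariance under a unitary change of columns\<close>

lemma rank_one_at_factorization:
  fixes D :: "'i \<Rightarrow> 'i \<Rightarrow> 'k::field"
  assumes "rank_one_at D z" "D z z \<noteq> 0"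
  obtains v w where "\<And>x y. D x y = v x * w y"
proof
  show "D x y = D x z / D z z * D z y" for x y
    using assms by (simp add: rank_one_at_def field_simps)
qed

text \<open>The Gram part transforms by sesquilinearity. The identity part transforms in the same way
  because the columns of \<open>U\<close> are orthonormal.\<close>

lemma gram_defect_unitary_change:
  assumes U: "unitary_matrix U"
    and b: "\<And>i p. b i p = (\<Sum>k\<in>UNIV. U $ k $ i *s a k p)"
  shows "gram_defect b (i, p') (j, p) =
    (\<Sum>k\<in>UNIV. \<Sum>l\<in>UNIV. U $ k $ i * cnj (U $ l $ j) * gram_defect a (k, p') (l, p))"
proof -
  have "(conj_transpose U ** U) $ j $ i = (mat 1 :: complex^2^2) $ j $ i"
    using U by (simp add: unitary_matrix_def)
  then have orth: "(\<Sum>k\<in>UNIV. U $ k $ i * cnj (U $ k $ j)) = (if i = j then 1 else 0)"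
    by (auto simp: conj_transpose_def matrix_matrix_mult_def mat_def mult.commute)
  have id: "(\<Sum>k\<in>UNIV. \<Sum>l\<in>UNIV.
      U $ k $ i * cnj (U $ l $ j) * (if (k, p') = (l, p) then 1 else 0)) =
      (if (i, p') = (j, p) then 1 else 0)"
    using orth by (cases "p' = p") (simp_all add: if_distrib[of "\<lambda>x. _ * x"] cong: if_cong)
  have gram: "cinner (b i m) (b j n) =
      (\<Sum>k\<in>UNIV. \<Sum>l\<in>UNIV. U $ k $ i * cnj (U $ l $ j) * cinner (a k m) (a l n))" for m n
    unfolding b cinner_sum_left cinner_scale_left
    unfolding cinner_sum_right cinner_scale_right
    by (simp only: sum_distrib_left mult.assoc)
  show ?thesis
    unfolding gram_defect_def fst_conv snd_conv gram id[symmetric]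
    by (simp add: sum_2 sum.distrib sum_distrib_left right_diff_distrib)
qed

text \<open>The hypothesis \<open>norm (a 1 0) < 1\<close> makes the pivot nonzero, so that one can divide by it. The pivot of the
  transformed defect may vanish, which does no harm since a product \<open>v x * w y\<close> has vanishing
  minors everywhere.\<close>

lemma conditions_unitary_change:
  assumes U: "unitary_matrix U"
    and b: "\<And>i p. b i p = (\<Sum>k\<in>UNIV. U $ k $ i *s a k p)"
    and less: "norm (a 1 0) < 1"
    and cond: "conditions_I_to_V (a 1) (a 2)"
  shows "conditions_I_to_V (b 1) (b 2)"
proof -
  have "(norm (a 1 0))\<^sup>2 < 1"
    using less by (simp add: abs_square_less_1)
  then have "gram_defect a (1, 0) (1, 0) \<noteq> 0"
    unfolding gram_defect_diagonal by (simp del: of_real_diff)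
  then obtain v w where vw: "\<And>x y. gram_defect a x y = v x * w y"
    using cond rank_one_at_factorization unfolding conditions_iff_rank_one by metis
  have "gram_defect b (i, p') (j, p) =
      (\<Sum>k\<in>UNIV. U $ k $ i * v (k, p')) * (\<Sum>l\<in>UNIV. cnj (U $ l $ j) * w (l, p))" for i p' j p
    unfolding gram_defect_unitary_change[OF U b] vw sum_product by (simp add: mult_ac)
  then show ?thesis
    unfolding conditions_iff_rank_one rank_one_at_def by (simp add: split_paired_all)
qed

section \<open>Integration over the circle\<close>

lemma continuous_imp_circle_measurable:
  "continuous_on (sphere 0 1) g \<Longrightarrow> g \<in> borel_measurable circle_measure"
  for g :: "complex \<Rightarrow> 'b::topological_space"
  unfolding circle_measure_def
  by (intro measurable_completion) (auto intro: borel_measurable_continuous_on_restrict)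

lemma cis_measurable_circle:
  "cis \<in> uniform_measure lborel {0..<2 * pi} \<rightarrow>\<^sub>M restrict_space borel (sphere 0 1)"
  by (rule measurable_restrict_space2)
    (auto intro!: borel_measurable_continuous_onI continuous_intros
      simp: measurable_cong_sets[OF sets_uniform_measure])

lemma emeasure_space_circle_measure: "emeasure circle_measure (space circle_measure) = 1"
proof -
  have "emeasure (uniform_measure lborel {0..<2*pi}) UNIV = 1"
    by (subst emeasure_uniform_measure) auto
  then have "(\<integral>\<^sup>+\<omega>. 1 \<partial>circle_measure) = 1"
    unfolding circle_measure_def nn_integral_completion
    by (subst nn_integral_distr[OF cis_measurable_circle]) auto
  then show ?thesis by simp
qed

lemma finite_measure_circle_measure: "finite_measure circle_measure"
  by (rule finite_measureI) (simp add: emeasure_space_circle_measure)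

lemma continuous_imp_circle_integrable:
  fixes g :: "complex \<Rightarrow> 'b::{banach,second_countable_topology}"
  assumes "continuous_on UNIV g"
  shows "integrable circle_measure g"
proof -
  interpret finite_measure circle_measure by (rule finite_measure_circle_measure)
  have "compact (g ` sphere 0 1)"
    by (intro compact_continuous_image continuous_on_subset[OF assms]) auto
  then obtain C where "\<forall>\<omega>\<in>sphere 0 1. norm (g \<omega>) \<le> C"
    using compact_imp_bounded bounded_iff by (metis imageI)
  moreover have "space circle_measure = sphere 0 1"
    by (simp add: circle_measure_def space_restrict_space)
  ultimately show ?thesis
    by (intro integrable_const_bound[where B = C] AE_I2 continuous_imp_circle_measurable
        continuous_on_subset[OF assms]) auto
qed

lemma integral_circle_measure:
  fixes g :: "complex \<Rightarrow> complex"
  assumes "continuous_on UNIV g"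
  shows "(\<integral>\<omega>. g \<omega> \<partial>circle_measure) =
    (\<integral>t. indicator {0..2 * pi} t *\<^sub>R g (cis t) \<partial>lborel) / (2 * pi)"
proof -
  have g[measurable]: "g \<in> borel_measurable borel"
    by (rule borel_measurable_continuous_onI[OF assms])
  have c[measurable]: "cis \<in> borel_measurable borel"
    by (auto intro!: borel_measurable_continuous_onI continuous_intros)
  have "(\<integral>\<omega>. g \<omega> \<partial>circle_measure) = (\<integral>t. g (cis t) \<partial>uniform_measure lborel {0..<2 * pi})"
    unfolding circle_measure_def
    by (subst integral_completion)
      (use cis_measurable_circle in \<open>auto simp: integral_distr measurable_restrict_space1\<close>)
  also have "uniform_measure lborel {0..<2 * pi} =
      density lborel (\<lambda>t. ennreal (indicator {0..<2 * pi} t / (2 * pi)))"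
    unfolding uniform_measure_def
    by (intro density_cong) (auto split: split_indicator simp: divide_ennreal[symmetric] zero_less_mult_iff)
  also have "(\<integral>t. g (cis t) \<partial>\<dots>) = (\<integral>t. (indicator {0..<2 * pi} t / (2 * pi)) *\<^sub>R g (cis t) \<partial>lborel)"
    by (subst integral_density) auto
  \<comment> \<open>The fundamental theorem of calculus is applied on closed intervals, so the end point
     is added.\<close>
  also have "\<dots> = (\<integral>t. (indicator {0..2 * pi} t *\<^sub>R g (cis t)) / (2 * pi) \<partial>lborel)"
  proof (rule integral_cong_AE)
    show "AE t in lborel. (indicator {0..<2 * pi} t / (2 * pi)) *\<^sub>R g (cis t) =
        (indicator {0..2 * pi} t *\<^sub>R g (cis t)) / (2 * pi)"
      using AE_lborel_singleton[of "2 * pi"]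
      by eventually_elim (auto split: split_indicator simp: scaleR_conv_of_real)
  qed auto
  finally show ?thesis by simp
qed

text \<open>On the circle \<open>\<omega> ^ k * cnj (\<omega> ^ l)\<close> is \<open>cis (m * t)\<close> with \<open>m = k - l\<close>, which for
  \<open>m \<noteq> 0\<close> has the \<open>2 * pi\<close>-periodic antiderivative \<open>cis (m * t) / (\<i> * m)\<close>.\<close>

lemma integral_circle_characters:
  "(\<integral>\<omega>. \<omega> ^ k * cnj (\<omega> ^ l) \<partial>circle_measure) = (if k = l then 1 else 0)"
proof -
  define m where "m = real k - real l"
  have char: "cis t ^ k * cnj (cis t ^ l) = cis (m * t)" for t
    by (simp only: complex_cnj_power cis_cnj Complex.DeMoivre cis_mult) (simp add: m_def algebra_simps)
  have eq: "(\<integral>\<omega>. \<omega> ^ k * cnj (\<omega> ^ l) \<partial>circle_measure) =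
      (\<integral>t. indicator {0..2 * pi} t *\<^sub>R cis (m * t) \<partial>lborel) / (2 * pi)"
    by (subst integral_circle_measure) (auto intro!: continuous_intros simp: char simp del: complex_cnj_power)
  show ?thesis
  proof (cases "k = l")
    case True
    then show ?thesis unfolding eq by (simp add: m_def scaleR_conv_of_real)
  next
    case False
    then have m: "m \<noteq> 0" by (simp add: m_def)
    have "(\<integral>t. indicator {0..2 * pi} t *\<^sub>R cis (m * t) \<partial>lborel) =
        cis (m * (2 * pi)) / (\<i> * m) - cis (m * 0) / (\<i> * m)"
    proof (rule integral_FTC_Icc)
      show "((\<lambda>t. cis (m * t) / (\<i> * m)) has_vector_derivative cis (m * t))
          (at t within {0..2 * pi})" for t
      proof -
        have "((\<lambda>z. exp (\<i> * (m * z)) / (\<i> * m)) has_field_derivative exp (\<i> * (m * t)))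
            (at (complex_of_real t))"
          using m by (auto intro!: derivative_eq_intros simp: algebra_simps)
        from has_vector_derivative_real_field[OF this] show ?thesis
          by (simp add: cis_conv_exp)
      qed
    qed (auto intro!: continuous_intros)
    moreover have "cis (m * (2 * pi)) = 1"
      using cis_multiple_2pi[of m] by (simp add: m_def mult.commute mult.left_commute)
    ultimately show ?thesis unfolding eq using False by simp
  qed
qed

section \<open>Uniqueness and linearity of Taylor coefficients\<close>

lemma continuous_scale_vec [continuous_intros]:
  assumes "continuous_on S c" "continuous_on S f"
  shows "continuous_on S (\<lambda>x. c x *s (f x :: complex^2))"
  unfolding vector_scalar_mult_def
  by (intro continuous_on_vec_lambda continuous_intros assms)

text \<open>Expanding the square sesquilinearly leaves only the diagonal terms, by orthonormality of the
  characters.\<close>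

lemma parseval_polynomial:
  fixes h :: "nat \<Rightarrow> complex^2"
  shows "(\<integral>\<^sup>+\<omega>. ennreal ((norm (\<Sum>k<n. \<omega> ^ k *s h k))\<^sup>2) \<partial>circle_measure) =
    ennreal (\<Sum>k<n. (norm (h k))\<^sup>2)"
proof -
  let ?P = "\<lambda>\<omega>. \<Sum>k<n. \<omega> ^ k *s h k"
  have int: "integrable circle_measure (\<lambda>\<omega>. (norm (?P \<omega>))\<^sup>2)"
    by (intro continuous_imp_circle_integrable continuous_intros)
  have integrable_term: "integrable circle_measure (\<lambda>\<omega>. (\<omega> ^ k * cnj (\<omega> ^ l)) * c)" for k l c
    by (intro continuous_imp_circle_integrable continuous_intros)
  have integral_term: "(\<integral>\<omega>. (\<omega> ^ k * cnj (\<omega> ^ l)) * c \<partial>circle_measure) =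
      (if k = l then 1 else 0) * c" for k l c
    using integrable_term[of k l 1]
    by (subst Bochner_Integration.integral_mult_left) (simp_all only: integral_circle_characters mult_1_right)
  have "complex_of_real (\<integral>\<omega>. (norm (?P \<omega>))\<^sup>2 \<partial>circle_measure) =
      (\<integral>\<omega>. cinner (?P \<omega>) (?P \<omega>) \<partial>circle_measure)"
    unfolding cinner_self by (simp del: of_real_power)
  also have "\<dots> = (\<integral>\<omega>. (\<Sum>k<n. \<Sum>l<n. (\<omega> ^ k * cnj (\<omega> ^ l)) * cinner (h k) (h l)) \<partial>circle_measure)"
    unfolding cinner_sum_left
    unfolding cinner_sum_right cinner_scale_left cinner_scale_right by (simp only: mult_ac)
  also have "\<dots> = (\<Sum>k<n. \<Sum>l<n. (if k = l then 1 else 0) * cinner (h k) (h l))"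
    by (simp only: Bochner_Integration.integral_sum Bochner_Integration.integrable_sum
        integrable_term integral_term)
  also have "\<dots> = (\<Sum>k<n. cinner (h k) (h k))"
    by (simp add: if_distrib[of "\<lambda>x. x * _"] cong: if_cong)
  also have "\<dots> = complex_of_real (\<Sum>k<n. (norm (h k))\<^sup>2)"
    by (simp add: cinner_self)
  finally have "(\<integral>\<omega>. (norm (?P \<omega>))\<^sup>2 \<partial>circle_measure) = (\<Sum>k<n. (norm (h k))\<^sup>2)"
    by (simp only: of_real_eq_iff)
  then show ?thesis
    using int by (simp add: nn_integral_eq_integral)
qed

lemma circle_measurable_polynomial:
  "(\<lambda>\<omega>. \<Sum>k<n. \<omega> ^ k *s (h k :: complex^2)) \<in> borel_measurable circle_measure"
  by (intro continuous_imp_circle_measurable continuous_intros)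

lemma norm_scale_vec: "norm (c *s (x :: complex^2)) = cmod c * norm x"
  by (simp add: norm_vec_def L2_set_def norm_mult power_mult_distrib sum_distrib_left[symmetric]
      real_sqrt_mult)

lemma norm_square_combination_le:
  "(norm (c *s x + d *s (y :: complex^2)))\<^sup>2 \<le>
    2 * (cmod c)\<^sup>2 * (norm x)\<^sup>2 + 2 * (cmod d)\<^sup>2 * (norm y)\<^sup>2"
proof -
  have "(norm (c *s x + d *s y))\<^sup>2 \<le> (cmod c * norm x + cmod d * norm y)\<^sup>2"
    using norm_triangle_ineq[of "c *s x" "d *s y"] by (simp add: norm_scale_vec power_mono)
  also have "\<dots> \<le> 2 * (cmod c)\<^sup>2 * (norm x)\<^sup>2 + 2 * (cmod d)\<^sup>2 * (norm y)\<^sup>2"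
    using sum_squares_ge_zero[of "cmod c * norm x - cmod d * norm y" 0]
    by (simp add: power2_eq_square algebra_simps)
  finally show ?thesis .
qed

text \<open>The remainders of the series combine linearly, so the elementary bound on the square of a
  sum transfers convergence to \<open>0\<close> of the \<open>L\<^sup>2\<close> distances.\<close>

lemma hardy_series_combination:
  assumes f: "hardy_series f h" and g: "hardy_series g k"
  shows "hardy_series (\<lambda>\<omega>. c *s f \<omega> + d *s g \<omega>) (\<lambda>n. c *s h n + d *s k n)"
proof -
  let ?C = "2 * (cmod c)\<^sup>2" and ?D = "2 * (cmod d)\<^sup>2"
  let ?F = "\<lambda>n \<omega>. (norm (f \<omega> - (\<Sum>i<n. \<omega> ^ i *s h i)))\<^sup>2"
  let ?G = "\<lambda>n \<omega>. (norm (g \<omega> - (\<Sum>i<n. \<omega> ^ i *s k i)))\<^sup>2"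
  let ?S = "\<lambda>n \<omega>. (norm ((c *s f \<omega> + d *s g \<omega>) - (\<Sum>i<n. \<omega> ^ i *s (c *s h i + d *s k i))))\<^sup>2"
  have [measurable]: "f \<in> borel_measurable circle_measure" "g \<in> borel_measurable circle_measure"
    using f g by (simp_all add: hardy_series_def)
  note circle_measurable_polynomial[measurable]
  have [measurable]: "(\<lambda>x. e *s (x :: complex^2)) \<in> borel_measurable borel" for e
    by (intro borel_measurable_continuous_onI continuous_intros)
  have split: "(c *s f \<omega> + d *s g \<omega>) - (\<Sum>i<n. \<omega> ^ i *s (c *s h i + d *s k i)) =
      c *s (f \<omega> - (\<Sum>i<n. \<omega> ^ i *s h i)) + d *s (g \<omega> - (\<Sum>i<n. \<omega> ^ i *s k i))" for n \<omega>
    by (simp add: vec_eq_iff sum_distrib_left sum.distrib algebra_simps)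
  have bound: "(\<integral>\<^sup>+\<omega>. ennreal (?S n \<omega>) \<partial>circle_measure) \<le>
      ennreal ?C * (\<integral>\<^sup>+\<omega>. ennreal (?F n \<omega>) \<partial>circle_measure) +
      ennreal ?D * (\<integral>\<^sup>+\<omega>. ennreal (?G n \<omega>) \<partial>circle_measure)" for n
  proof -
    have "(\<integral>\<^sup>+\<omega>. ennreal (?S n \<omega>) \<partial>circle_measure) \<le>
        (\<integral>\<^sup>+\<omega>. ennreal ?C * ennreal (?F n \<omega>) + ennreal ?D * ennreal (?G n \<omega>) \<partial>circle_measure)"
    proof (rule nn_integral_mono)
      fix \<omega>
      show "ennreal (?S n \<omega>) \<le> ennreal ?C * ennreal (?F n \<omega>) + ennreal ?D * ennreal (?G n \<omega>)"
        unfolding split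
        using ennreal_leI[OF norm_square_combination_le]
        by (simp only: ennreal_mult[symmetric] ennreal_plus[symmetric] zero_le_power2
            mult_nonneg_nonneg zero_le_numeral)
    qed
    also have "\<dots> = ennreal ?C * (\<integral>\<^sup>+\<omega>. ennreal (?F n \<omega>) \<partial>circle_measure) +
      ennreal ?D * (\<integral>\<^sup>+\<omega>. ennreal (?G n \<omega>) \<partial>circle_measure)"
      by (subst nn_integral_add) (auto simp: nn_integral_cmult)
    finally show ?thesis .
  qed
  have "(\<lambda>n. ennreal ?C * (\<integral>\<^sup>+\<omega>. ennreal (?F n \<omega>) \<partial>circle_measure) +
      ennreal ?D * (\<integral>\<^sup>+\<omega>. ennreal (?G n \<omega>) \<partial>circle_measure)) \<longlonglongrightarrow> 0"
  proof -
    have "(\<lambda>n. \<integral>\<^sup>+\<omega>. ennreal (?F n \<omega>) \<partial>circle_measure) \<longlonglongrightarrow> 0"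
      "(\<lambda>n. \<integral>\<^sup>+\<omega>. ennreal (?G n \<omega>) \<partial>circle_measure) \<longlonglongrightarrow> 0"
      using f g unfolding hardy_series_def by blast+
    then show ?thesis
      using tendsto_add[OF ennreal_tendsto_cmult[of ?C] ennreal_tendsto_cmult[of ?D]] by fastforce
  qed
  then have lim: "(\<lambda>n. \<integral>\<^sup>+\<omega>. ennreal (?S n \<omega>) \<partial>circle_measure) \<longlonglongrightarrow> 0"
  proof (rule tendsto_sandwich[OF _ _ tendsto_const, rotated 2])
    show "\<forall>\<^sub>F n in sequentially. (\<integral>\<^sup>+\<omega>. ennreal (?S n \<omega>) \<partial>circle_measure) \<le>
        ennreal ?C * (\<integral>\<^sup>+\<omega>. ennreal (?F n \<omega>) \<partial>circle_measure) +
        ennreal ?D * (\<integral>\<^sup>+\<omega>. ennreal (?G n \<omega>) \<partial>circle_measure)"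
      using bound by (intro always_eventually allI)
  qed simp
  have "summable (\<lambda>n. ?C * (norm (h n))\<^sup>2 + ?D * (norm (k n))\<^sup>2)"
    using f g unfolding hardy_series_def by (intro summable_add summable_mult) auto
  then have "summable (\<lambda>n. (norm (c *s h n + d *s k n))\<^sup>2)"
    by (rule summable_comparison_test'[where N = 0]) (simp add: norm_square_combination_le)
  with lim show ?thesis
    unfolding hardy_series_def by simp
qed

text \<open>By linearity the differences of the coefficients form a series for the zero function, and
  Parseval's identity turns convergence of its partial sums to \<open>0\<close> into vanishing of each
  coefficient.\<close>

lemma hardy_series_unique:
  assumes "hardy_series f h" "hardy_series f h'"
  shows "h = h'"
proof
  fix j
  let ?e = "\<lambda>k. h k - h' k"
  have "hardy_series (\<lambda>\<omega>. 1 *s f \<omega> + (-1) *s f \<omega>) (\<lambda>n. 1 *s h n + (-1) *s h' n)"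
    using assms by (rule hardy_series_combination)
  moreover have "(\<lambda>\<omega>. 1 *s f \<omega> + (-1) *s f \<omega>) = (\<lambda>\<omega>. 0)" "(\<lambda>n. 1 *s h n + (-1) *s h' n) = ?e"
    by (auto simp: vec_eq_iff)
  ultimately have "hardy_series (\<lambda>\<omega>. 0) ?e" by simp
  then have lim: "(\<lambda>n. ennreal (\<Sum>k<n. (norm (?e k))\<^sup>2)) \<longlonglongrightarrow> 0"
    by (simp only: hardy_series_def diff_0 norm_minus_cancel parseval_polynomial)
  have "ennreal ((norm (?e j))\<^sup>2) \<le> 0"
  proof (rule tendsto_lowerbound[OF lim])
    show "\<forall>\<^sub>F n in sequentially. ennreal ((norm (?e j))\<^sup>2) \<le> ennreal (\<Sum>k<n. (norm (?e k))\<^sup>2)"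
      using eventually_gt_at_top[of j]
      by eventually_elim (intro ennreal_leI member_le_sum, auto)
  qed simp
  then show "h j = h' j" by simp
qed

lemma taylor_coeffs_eqI: "hardy_series f h \<Longrightarrow> taylor_coeffs f = h"
  unfolding taylor_coeffs_def using hardy_series_unique by blast

lemma hardy_series_taylor_coeffs: "f \<in> hardy_space \<Longrightarrow> hardy_series f (taylor_coeffs f)"
  unfolding hardy_space_def using taylor_coeffs_eqI by auto

lemma taylor_coeffs_combination:
  assumes "f \<in> hardy_space" "g \<in> hardy_space"
  shows "taylor_coeffs (\<lambda>\<omega>. c *s f \<omega> + d *s g \<omega>) =
    (\<lambda>n. c *s taylor_coeffs f n + d *s taylor_coeffs g n)"
  using assms by (intro taylor_coeffs_eqI hardy_series_combination hardy_series_taylor_coeffs)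

section \<open>Unitary changes of inner functions\<close>

text \<open>The first two clauses for \<open>A \<omega> ** U\<close> at \<open>h\<close> are those for \<open>A \<omega>\<close> at \<open>U *v h\<close>. By
  unitarity the common initial space is the whole of the space.\<close>

lemma M_plus_inner_unitary_change:
  assumes A: "M_plus_inner A"
    and unitary: "AE \<omega> in circle_measure. unitary_matrix (A \<omega> ** U)"
  shows "M_plus_inner (\<lambda>\<omega>. A \<omega> ** U)"
proof -
  have "AE \<omega> in circle_measure. partial_isometry_with_initial_space (A \<omega> ** U) UNIV"
    using unitary by eventually_elim (rule unitary_matrix_partial_isometry)
  then show ?thesis
    using A unfolding M_plus_inner_def matrix_vector_mul_assoc[symmetric] by blast
qed

theorem proposition3p13:
  fixes A B :: "complex \<Rightarrow> complex^2^2"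
    and a0 a1 b0 b1 :: "complex \<Rightarrow> complex^2"
    and U :: "complex^2^2"
  assumes a0: "a0 = (\<lambda>\<omega>. column 1 (A \<omega>))"
    and a1: "a1 = (\<lambda>\<omega>. column 2 (A \<omega>))"
    and A_inner: "M_plus_inner A"
    and A_unitary: "AE \<omega> in circle_measure. unitary_matrix (A \<omega>)"
    and columns_hardy: "a0 \<in> hardy_space" "a1 \<in> hardy_space"
    and norm_less: "norm (taylor_coeffs a0 0) < 1"
    and conditions: "conditions_I_to_V (taylor_coeffs a0) (taylor_coeffs a1)"
    and U_unitary: "unitary_matrix U"
    and B: "B = (\<lambda>\<omega>. A \<omega> ** U)"
    and b0: "b0 = (\<lambda>\<omega>. column 1 (B \<omega>))"
    and b1: "b1 = (\<lambda>\<omega>. column 2 (B \<omega>))"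
  shows "M_plus_inner B \<and>
         (AE \<omega> in circle_measure. unitary_matrix (B \<omega>)) \<and>
         conditions_I_to_V (taylor_coeffs b0) (taylor_coeffs b1)"
proof (intro conjI)
  show unitary: "AE \<omega> in circle_measure. unitary_matrix (B \<omega>)"
    unfolding B using A_unitary by eventually_elim (rule unitary_matrix_mult[OF _ U_unitary])
  then show "M_plus_inner B"
    unfolding B by (rule M_plus_inner_unitary_change[OF A_inner])
  define a where "a i = taylor_coeffs (\<lambda>\<omega>. column i (A \<omega>))" for i
  define b where "b i = taylor_coeffs (\<lambda>\<omega>. column i (B \<omega>))" for i
  have column: "column i (B \<omega>) = U $ 1 $ i *s column 1 (A \<omega>) + U $ 2 $ i *s column 2 (A \<omega>)" for i \<omega>
    by (simp add: B vec_eq_iff column_def matrix_matrix_mult_def sum_2 mult.commute)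
  have "b i p = (\<Sum>k\<in>UNIV. U $ k $ i *s a k p)" for i p
    using columns_hardy unfolding a_def b_def column a0 a1
    by (simp add: taylor_coeffs_combination sum_2)
  then have "conditions_I_to_V (b 1) (b 2)"
    using U_unitary norm_less conditions
    by (intro conditions_unitary_change[of U b a]) (simp_all add: a_def a0 a1)
  then show "conditions_I_to_V (taylor_coeffs b0) (taylor_coeffs b1)"
    by (simp add: b_def b0 b1)
qed

end
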